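(* Let $n\ge 7$ and let $f:E(K_{n,n})\to\{1,2\}$ be a coloring of the edges of the complete bipartite graph $K_{n,n}$. If $|f^{-1}(i)|\ge 2n-1$ for $i=1,2$, then there exists a partition of $E(K_{n,n})$ into $n$ pairwise disjoint balanced matchings.
   Context: Given an edge coloring $f:E(K_{n,n})\to\{1,2\}$, a matching $P\subset E(K_{n,n})$ is balanced if $f^{-1}(i)\cap P\neq\emptyset$ for $i=1,2$. *)

theory Defs
  imports Main "HOL-Library.Disjoint_Sets" "HOL-Library.FuncSet"
begin

(* The two sides of K_{n,n} are the copies Inl ` {..<n} and Inr ` {..<n} of {..<n}. *)
definition complete_bipartite_edges :: "nat \<Rightarrow> (nat + nat) set set" where
  "complete_bipartite_edges n = {{Inl i, Inr j} | i j. i < n \<and> j < n}"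

definition matching :: "'v set set \<Rightarrow> 'v set set \<Rightarrow> bool" where
  "matching E P \<longleftrightarrow> P \<subseteq> E \<and> disjoint P"

(* The fibre of f over i, for f regarded as a map with domain E. *)
definition color_class :: "'e set \<Rightarrow> ('e \<Rightarrow> nat) \<Rightarrow> nat \<Rightarrow> 'e set" where
  "color_class E f i = {e \<in> E. f e = i}"

definition balanced_matching :: "'v set set \<Rightarrow> ('v set \<Rightarrow> nat) \<Rightarrow> 'v set set \<Rightarrow> bool" where
  "balanced_matching E f P \<longleftrightarrow> matching E P \<and> (\<forall>i\<in>{1, 2}. color_class E f i \<inter> P \<noteq> {})"

end

theory Submission
  imports Defs
begin

text \<open>
  Since each of the \<open>n\<close> matchings has at most \<open>n\<close> edges, the matchings are the symbols of a Latin
  square whose rows and columns are the two sides of the graph. So for every 2-coloring of the cells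
  of an \<open>n \<times> n\<close> array one needs a Latin square in which every symbol occurs on both colors.

  Prescribe distinct symbols on \<open>n\<close> red cells lying in few rows, so that every symbol occurs on a red
  cell. If all red cells of two different rows are among them, then no symbol is red in both of these
  rows, so every symbol also occurs on a blue cell. Under numerical conditions the rows can be filled
  one after the other by Hall's theorem, and a Latin rectangle always extends to a Latin square.
  Taking the rows with the most red cells puts every symbol on a red cell. It also puts every symbol
  on a blue cell if some row is entirely blue, or if any two rows together have fewer than \<open>n\<close> red
  cells. If neither this nor the same with the colors exchanged applies, then two or three rows
  suffice, among them one with the most or one with the fewest red cells. The only exception are
  the colorings in which every row is monochromatic up to one cell, all these cells lying in the
  same column; then any Latin square works.
\<close>

section \<open>Hall's theorem\<close>

text \<open>Halmos-Vaughan induction. If a proper nonempty \<open>J\<close> is tight, match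
  \<open>J\<close> and \<open>I - J\<close> separately. If none is tight, match one index
  arbitrarily: the strict inequalities absorb the loss of one element.\<close>

lemma hall_marriage:
  fixes A :: "'a \<Rightarrow> 'b set"
  assumes "finite I" and "\<And>i. i \<in> I \<Longrightarrow> finite (A i)"
    and "\<And>J. J \<subseteq> I \<Longrightarrow> card J \<le> card (\<Union>(A ` J))"
  shows "\<exists>h. inj_on h I \<and> (\<forall>i\<in>I. h i \<in> A i)"
  using assms
proof (induction "card I" arbitrary: I A rule: less_induct)
  case less
  note finI = less.prems(1) and finA = less.prems(2) and cond = less.prems(3)
  show ?case
  proof (cases "I = {}")
    case False
    show ?thesis
    proof (cases "\<exists>J. J \<subset> I \<and> J \<noteq> {} \<and> card J = card (\<Union>(A ` J))")
      case True
      then obtain J where J: "J \<subset> I" "J \<noteq> {}" "card J = card (\<Union>(A ` J))"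
        by blast
      have finJ: "finite J"
        using J(1) finI by (meson finite_subset psubset_imp_subset)
      have finU: "finite (\<Union>(A ` K))" if "K \<subseteq> I" for K
        using that finI finA by (meson finite_UN finite_subset subsetD)
      have "\<exists>h. inj_on h J \<and> (\<forall>i\<in>J. h i \<in> A i)"
      proof (rule less.hyps)
        show "card J < card I"
          using J(1) finI by (rule psubset_card_mono [rotated])
      qed (use J(1) finJ finA cond in auto)
      then obtain h1 where h1: "inj_on h1 J" "\<forall>i\<in>J. h1 i \<in> A i"
        by blast
      \<comment> \<open>Since \<open>J\<close> is tight, subtracting its equality from the condition
        for \<open>J \<union> K\<close> leaves the condition for \<open>K\<close> and the reduced
        sets \<open>B\<close>.\<close>
      define B where "B i = A i - \<Union>(A ` J)" for i
      have "\<exists>h. inj_on h (I - J) \<and> (\<forall>i\<in>I - J. h i \<in> B i)"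
      proof (rule less.hyps)
        show "card (I - J) < card I"
          using J finI by (intro psubset_card_mono) auto
        show "finite (I - J)" "\<And>i. i \<in> I - J \<Longrightarrow> finite (B i)"
          using finI finA by (auto simp: B_def)
      next
        fix K assume K: "K \<subseteq> I - J"
        have finK: "finite K"
          using K finI by (meson finite_Diff finite_subset)
        have "card J + card K = card (J \<union> K)"
          using K finJ finK by (intro card_Un_disjoint [symmetric]) auto
        also have "\<dots> \<le> card (\<Union>(A ` (J \<union> K)))"
          using J K by (intro cond) auto
        also have "\<Union>(A ` (J \<union> K)) = \<Union>(A ` J) \<union> \<Union>(B ` K)"
          by (auto simp: B_def)
        also have "card \<dots> \<le> card (\<Union>(A ` J)) + card (\<Union>(B ` K))"
          by (rule card_Un_le)
        finally show "card K \<le> card (\<Union>(B ` K))"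
          using J(3) by simp
      qed
      then obtain h2 where h2: "inj_on h2 (I - J)" "\<forall>i\<in>I - J. h2 i \<in> B i"
        by blast
      define h where "h i = (if i \<in> J then h1 i else h2 i)" for i
      have "inj_on h I"
      proof (rule inj_onI)
        fix x y assume xy: "x \<in> I" "y \<in> I" "h x = h y"
        have sep: "h2 u \<noteq> h1 v" if "u \<in> I - J" "v \<in> J" for u v
          using h1(2) h2(2) that unfolding B_def by blast
        have "x \<in> J \<longleftrightarrow> y \<in> J"
          using xy sep [of x y] sep [of y x] by (auto simp: h_def split: if_splits)
        then show "x = y"
          using xy h1(1) h2(1) unfolding h_def by (auto split: if_splits dest: inj_onD)
      qed
      moreover have "\<forall>i\<in>I. h i \<in> A i"
        using h1(2) h2(2) by (auto simp: h_def B_def)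
      ultimately show ?thesis
        by blast
    next
      case notight: False
      obtain i where i: "i \<in> I"
        using False by blast
      have "card {i} \<le> card (\<Union>(A ` {i}))"
        using i by (intro cond) auto
      then obtain x where x: "x \<in> A i"
        by fastforce
      define B where "B j = A j - {x}" for j
      have "\<exists>h. inj_on h (I - {i}) \<and> (\<forall>j\<in>I - {i}. h j \<in> B j)"
      proof (rule less.hyps)
        show "card (I - {i}) < card I"
          using i finI by (intro psubset_card_mono) auto
        show "finite (I - {i})" "\<And>j. j \<in> I - {i} \<Longrightarrow> finite (B j)"
          using finI finA by (auto simp: B_def)
      next
        fix K assume K: "K \<subseteq> I - {i}"
        show "card K \<le> card (\<Union>(B ` K))"
        proof (cases "K = {}")
          case False
          have "card K \<noteq> card (\<Union>(A ` K))"
            using notight False K i by blast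
          moreover have "card K \<le> card (\<Union>(A ` K))"
            using K by (intro cond) auto
          ultimately have "card K < card (\<Union>(A ` K))"
            by simp
          moreover have "\<Union>(B ` K) = \<Union>(A ` K) - {x}"
            by (auto simp: B_def)
          moreover have "card (\<Union>(A ` K)) \<le> card (\<Union>(A ` K) - {x}) + 1"
            using diff_card_le_card_Diff [of "{x}" "\<Union>(A ` K)"] by simp
          ultimately show ?thesis
            by simp
        qed simp
      qed
      then obtain h where h: "inj_on h (I - {i})" "\<forall>j\<in>I - {i}. h j \<in> B j"
        by blast
      have "inj_on (h(i := x)) I"
        using h by (auto simp: inj_on_def B_def)
      moreover have "\<forall>j\<in>I. (h(i := x)) j \<in> A j"
        using h x by (auto simp: B_def)
      ultimately show ?thesis
        by blast
    qed
  qed simp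
qed

text \<open>Hall's condition in terms of forbidden pairs: a set \<open>X\<close> has too few allowed
  values only if the set \<open>Y\<close> of values forbidden to all of \<open>X\<close> is too
  large.\<close>

lemma avoiding_bijection:
  fixes F :: "'a \<Rightarrow> 'b \<Rightarrow> bool"
  assumes fin: "finite C" "finite S" and card_eq: "card C = card S"
    and small: "\<And>X Y. \<lbrakk>X \<subseteq> C; Y \<subseteq> S; X \<noteq> {}; Y \<noteq> {}; \<forall>x\<in>X. \<forall>y\<in>Y. F x y\<rbrakk>
      \<Longrightarrow> card X + card Y \<le> card C"
  shows "\<exists>h. bij_betw h C S \<and> (\<forall>x\<in>C. \<not> F x (h x))"
proof -
  define N where "N x = {y \<in> S. \<not> F x y}" for x
  have "\<exists>h. inj_on h C \<and> (\<forall>x\<in>C. h x \<in> N x)"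
  proof (rule hall_marriage)
    fix X assume X: "X \<subseteq> C"
    define Y where "Y = S - \<Union>(N ` X)"
    have sub: "\<Union>(N ` X) \<subseteq> S"
      by (auto simp: N_def)
    have cY: "card Y + card (\<Union>(N ` X)) = card S"
      unfolding Y_def using sub fin(2)
      by (metis card_Diff_subset card_mono finite_subset le_add_diff_inverse2)
    have "card X + card Y \<le> card C" if "X \<noteq> {}" "Y \<noteq> {}"
      using that X by (intro small) (auto simp: Y_def N_def)
    moreover have "card X \<le> card C"
      using X fin(1) by (rule card_mono [rotated])
    ultimately show "card X \<le> card (\<Union>(N ` X))"
      using cY card_eq by (cases "X = {} \<or> Y = {}") auto
  qed (use fin in \<open>auto simp: N_def\<close>)
  then obtain h where h: "inj_on h C" "\<forall>x\<in>C. h x \<in> N x"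
    by blast
  then have "h ` C \<subseteq> S"
    by (auto simp: N_def)
  then have "bij_betw h C S"
    using h(1) fin card_eq by (simp add: bij_betw_def card_image card_subset_eq)
  then show ?thesis
    using h(2) by (auto simp: N_def)
qed

section \<open>Latin rectangles with prescribed entries\<close>

text \<open>The rows form an arbitrary set \<open>T\<close>, not an initial segment, because the
  rows fixed first may lie anywhere in the array.\<close>

definition latin_rows :: "nat \<Rightarrow> nat set \<Rightarrow> (nat \<Rightarrow> nat \<Rightarrow> nat) \<Rightarrow> bool" where
  "latin_rows n T L \<longleftrightarrow> (\<forall>i\<in>T. bij_betw (L i) {..<n} {..<n}) \<and>
     (\<forall>i\<in>T. \<forall>i'\<in>T. i \<noteq> i' \<longrightarrow> (\<forall>j<n. L i j \<noteq> L i' j))"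

lemma latin_rows_bij: "latin_rows n T L \<Longrightarrow> i \<in> T \<Longrightarrow> bij_betw (L i) {..<n} {..<n}"
  by (simp add: latin_rows_def)

lemma latin_rows_col_inj:
  "\<lbrakk>latin_rows n T L; i \<in> T; i' \<in> T; j < n; L i j = L i' j\<rbrakk> \<Longrightarrow> i = i'"
  unfolding latin_rows_def by blast

text \<open>The pairs of a column and a symbol not yet used in it form a regular bipartite graph of
  degree \<open>d = n - card T > 0\<close>, and such a graph has a perfect matching.\<close>

lemma latin_rows_add_row:
  assumes L: "latin_rows n T L" and T: "finite T" "card T < n" "i \<notin> T"
  shows "\<exists>L'. latin_rows n (insert i T) L' \<and> (\<forall>k\<in>T. L' k = L k)"
proof -
  define F where "F x y \<longleftrightarrow> (\<exists>k\<in>T. L k x = y)" for x y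
  define d where "d = n - card T"
  have bij: "bij_betw (L k) {..<n} {..<n}" if "k \<in> T" for k
    using L that by (rule latin_rows_bij)
  have row_deg: "card {y \<in> {..<n}. \<not> F x y} = d" if x: "x < n" for x
  proof -
    have "inj_on (\<lambda>k. L k x) T"
      using latin_rows_col_inj [OF L] x by (auto intro: inj_onI)
    then have "card ((\<lambda>k. L k x) ` T) = card T"
      by (rule card_image)
    moreover have "(\<lambda>k. L k x) ` T \<subseteq> {..<n}"
      using bij_betwE [OF bij] x by blast
    moreover have "{y \<in> {..<n}. \<not> F x y} = {..<n} - (\<lambda>k. L k x) ` T"
      by (auto simp: F_def)
    ultimately show ?thesis
      using T(1) by (simp add: d_def card_Diff_subset)
  qed
  have col_deg: "card {x \<in> {..<n}. \<not> F x y} = d" if y: "y < n" for y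
  proof -
    \<comment> \<open>\<open>q k\<close> is the column in which row \<open>k\<close> has the symbol
      \<open>y\<close>. These columns differ for different rows, so exactly \<open>card T\<close>
      columns are lost to \<open>y\<close>.\<close>
    define q where "q k = inv_into {..<n} (L k) y" for k
    have q: "q k < n" "L k (q k) = y" if "k \<in> T" for k
      using bij_betwE [OF bij_betw_inv_into [OF bij [OF that]]] y
        bij_betw_inv_into_right [OF bij [OF that]] by (auto simp: q_def)
    have "inj_on q T"
    proof (rule inj_onI)
      fix k k' assume "k \<in> T" "k' \<in> T" "q k = q k'"
      then show "k = k'"
        using latin_rows_col_inj [OF L, of k k' "q k"] q(1) q(2) [of k] q(2) [of k'] by simp
    qed
    then have "card (q ` T) = card T"
      by (rule card_image)
    moreover have "q ` T \<subseteq> {..<n}"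
      using q by auto
    moreover have "{x \<in> {..<n}. \<not> F x y} = {..<n} - q ` T"
    proof -
      have "x = q k" if "k \<in> T" "x < n" "L k x = y" for x k
        using inj_onD [OF bij_betw_imp_inj_on [OF bij [OF that(1)]], of x "q k"] that q [of k]
        by simp
      then have "F x y \<longleftrightarrow> x \<in> q ` T" if "x < n" for x
        using that q(2) unfolding F_def by blast
      then show ?thesis
        by blast
    qed
    ultimately show ?thesis
      using T(1) by (simp add: d_def card_Diff_subset)
  qed
  have "\<exists>h. bij_betw h {..<n} {..<n} \<and> (\<forall>x\<in>{..<n}. \<not> F x (h x))"
  proof (rule avoiding_bijection)
    fix X Y assume XY: "X \<subseteq> {..<n}" "Y \<subseteq> {..<n}" "\<forall>x\<in>X. \<forall>y\<in>Y. F x y"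
    have fin: "finite X" "finite Y"
      using XY by (auto intro: finite_subset)
    let ?N = "{..<n} - Y"
    \<comment> \<open>Double counting of the allowed pairs with column in \<open>X\<close>: their
      symbols all lie outside \<open>Y\<close>, and each of these symbols is in only
      \<open>d\<close> allowed pairs.\<close>
    have "card X * d = (\<Sum>x\<in>X. card {y \<in> {..<n}. \<not> F x y})"
      using XY row_deg by (simp add: subset_iff)
    also have "\<dots> = (\<Sum>x\<in>X. card {y \<in> ?N. \<not> F x y})"
      using XY by (intro sum.cong refl arg_cong [where f = card]) auto
    also have "\<dots> = (\<Sum>y\<in>?N. card {x \<in> X. \<not> F x y})"
      using fin by (intro sum_multicount_gen) auto
    also have "\<dots> \<le> (\<Sum>y\<in>?N. card {x \<in> {..<n}. \<not> F x y})"
      using XY by (intro sum_mono card_mono) auto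
    also have "\<dots> = card ?N * d"
      using col_deg by simp
    finally have "card X \<le> card ?N"
      using T by (simp add: d_def)
    then show "card X + card Y \<le> card {..<n}"
      using XY fin card_mono [OF _ XY(2)] by (simp add: card_Diff_subset)
  qed auto
  then obtain h where h: "bij_betw h {..<n} {..<n}" "\<forall>x<n. \<not> F x (h x)"
    by auto
  have "latin_rows n (insert i T) (L(i := h))"
    unfolding latin_rows_def
  proof (intro conjI ballI impI allI)
    fix k assume "k \<in> insert i T"
    then show "bij_betw ((L(i := h)) k) {..<n} {..<n}"
      using bij h(1) by auto
  next
    fix k k' j assume *: "k \<in> insert i T" "k' \<in> insert i T" "k \<noteq> k'" "j < n"
    have "L k j \<noteq> L k' j" if "k \<in> T" "k' \<in> T"
      using L * that by (auto simp: latin_rows_def)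
    moreover have "L k j \<noteq> h j" if "k \<in> T" for k
      using h(2) * that by (auto simp: F_def)
    ultimately show "(L(i := h)) k j \<noteq> (L(i := h)) k' j"
      using * by (auto simp: eq_commute)
  qed
  moreover have "\<forall>k\<in>T. (L(i := h)) k = L k"
    using T(3) by auto
  ultimately show ?thesis
    by blast
qed

lemma latin_rows_extend:
  assumes "latin_rows n T L" "T \<subseteq> {..<n}"
  shows "\<exists>L'. latin_rows n {..<n} L' \<and> (\<forall>k\<in>T. L' k = L k)"
  using assms
proof (induction "n - card T" arbitrary: T L rule: less_induct)
  case less
  have finT: "finite T"
    using less.prems(2) finite_subset by blast
  show ?case
  proof (cases "T = {..<n}")
    case True
    then show ?thesis
      using less.prems by blast
  next
    case False
    then obtain i where i: "i < n" "i \<notin> T"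
      using less.prems(2) by auto
    have lt: "card T < n"
      using False less.prems(2) by (metis card_lessThan finite_lessThan psubsetI psubset_card_mono)
    obtain L1 where L1: "latin_rows n (insert i T) L1" "\<forall>k\<in>T. L1 k = L k"
      using latin_rows_add_row [OF less.prems(1) finT lt i(2)] by blast
    have "n - card (insert i T) < n - card T"
      using lt i finT by simp
    from less.hyps [OF this L1(1)] obtain L' where
      "latin_rows n {..<n} L'" "\<forall>k\<in>insert i T. L' k = L1 k"
      using i less.prems(2) by auto
    then show ?thesis
      using L1(2) by (metis insertCI)
  qed
qed

text \<open>One step of the filling: rows below \<open>k\<close> are complete, and \<open>g\<close>
  prescribes distinct symbols on the cells of \<open>Sigma {..<t} A\<close>. The new row must keep
  its own prescribed symbols, differ from the earlier rows, and leave room for the symbols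
  prescribed in later rows. The assumption \<open>cond\<close> is what Hall's theorem needs for the
  free columns of row \<open>k\<close>.\<close>

lemma latin_rows_prefill_step:
  fixes L :: "nat \<Rightarrow> nat \<Rightarrow> nat" and g :: "nat \<times> nat \<Rightarrow> nat"
  assumes L: "latin_rows n {..<k} L" and k: "k < t"
    and A: "\<And>i. i < t \<Longrightarrow> A i \<subseteq> {..<n}"
    and g: "inj_on g (Sigma {..<t} A)" "g ` Sigma {..<t} A \<subseteq> {..<n}"
    and later: "\<And>i i' j. \<lbrakk>i < k; k \<le> i'; i' < t; j \<in> A i'\<rbrakk> \<Longrightarrow> L i j \<noteq> g (i', j)"
    and cond: "card (A k) + t + k \<le> n \<or> card (A k) + t + k \<le> n + 1 \<and>
      ((\<Sum>i\<in>{k<..<t}. card (A i)) + 1 < t \<or> (\<forall>x<n. x \<notin> A k \<longrightarrow> (\<exists>i. k < i \<and> i < t \<and> x \<notin> A i)))"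
  shows "\<exists>h. bij_betw h {..<n} {..<n} \<and> (\<forall>j\<in>A k. h j = g (k, j)) \<and>
    (\<forall>j<n. \<forall>i<k. L i j \<noteq> h j) \<and> (\<forall>i'. k < i' \<longrightarrow> i' < t \<longrightarrow> (\<forall>j\<in>A i'. h j \<noteq> g (i', j)))"
proof -
  define C where "C = {..<n} - A k"
  define G where "G = (\<lambda>j. g (k, j)) ` A k"
  define S where "S = {..<n} - G"
  define F where "F x y \<longleftrightarrow> (\<exists>i<k. L i x = y) \<or> (\<exists>i. k < i \<and> i < t \<and> x \<in> A i \<and> g (i, x) = y)" for x y
  have finA: "finite (A i)" if "i < t" for i
    using A [OF that] finite_subset by blast
  have gD: "i = i' \<and> j = j'" if "g (i, j) = g (i', j')" "i < t" "i' < t" "j \<in> A i" "j' \<in> A i'" for i i' j j'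
    using inj_onD [OF g(1) that(1)] that by auto
  have gn: "g (i, j) < n" if "i < t" "j \<in> A i" for i j
    using g(2) that by auto
  have gk: "inj_on (\<lambda>j. g (k, j)) (A k)"
    using gD k by (auto intro!: inj_onI)
  have Gn: "G \<subseteq> {..<n}"
    using gn k by (auto simp: G_def)
  have cardG: "card G = card (A k)"
    using gk by (simp add: G_def card_image)
  have cardC: "card C = n - card (A k)"
    using A [OF k] finA [OF k] by (simp add: C_def card_Diff_subset)
  have cardS: "card S = n - card (A k)"
    using Gn cardG by (simp add: S_def card_Diff_subset finite_subset)
  \<comment> \<open>A column excludes at most one symbol for each of the other rows. A symbol is excluded by one
    column for each earlier row and, since it is prescribed at most once, by one more.\<close>
  have "\<exists>h. bij_betw h C S \<and> (\<forall>x\<in>C. \<not> F x (h x))"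
  proof (rule avoiding_bijection)
    fix X Y assume XY: "X \<subseteq> C" "Y \<subseteq> S" "X \<noteq> {}" "Y \<noteq> {}" "\<forall>x\<in>X. \<forall>y\<in>Y. F x y"
    have finX: "finite X" and finY: "finite Y"
      using XY by (auto simp: C_def S_def intro: finite_subset)
    \<comment> \<open>\<open>v x i\<close> is the symbol that row \<open>i\<close> blocks in column
      \<open>x\<close>. All of \<open>Y\<close> is blocked in any single column of \<open>X\<close>,
      so \<open>Y\<close> is no larger than the number of rows blocking a symbol there.\<close>
    define v where "v x i = (if i < k then L i x else g (i, x))" for x i
    have Ysub: "Y \<subseteq> v x ` {i. i < k \<or> k < i \<and> i < t \<and> x \<in> A i}" if "x \<in> X" for x
    proof
      fix y assume "y \<in> Y"
      then have "F x y"
        using XY(5) that by blast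
      then show "y \<in> v x ` {i. i < k \<or> k < i \<and> i < t \<and> x \<in> A i}"
        unfolding F_def
      proof (elim disjE exE conjE)
        fix i assume "i < k" "L i x = y"
        then show ?thesis
          by (intro image_eqI [of _ _ i]) (auto simp: v_def)
      next
        fix i assume "k < i" "i < t" "x \<in> A i" "g (i, x) = y"
        then show ?thesis
          by (intro image_eqI [of _ _ i]) (auto simp: v_def)
      qed
    qed
    obtain x0 where x0: "x0 \<in> X"
      using XY(3) by blast
    have Y1: "card Y + 1 \<le> t"
    proof -
      have "Y \<subseteq> v x0 ` ({..<t} - {k})"
        using Ysub [OF x0] k by force
      then have "card Y \<le> card ({..<t} - {k})"
        by (meson surj_card_le finite_Diff finite_lessThan)
      then show ?thesis
        using k by simp
    qed
    have Y2: "card Y + 2 \<le> t" if "x \<in> X" "k < i" "i < t" "x \<notin> A i" for x i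
    proof -
      have "Y \<subseteq> v x ` ({..<t} - {k, i})"
        using Ysub [OF that(1)] k that by force
      then have "card Y \<le> card ({..<t} - {k, i})"
        by (meson surj_card_le finite_Diff finite_lessThan)
      then show ?thesis
        using k that by (simp add: card_Diff_subset)
    qed
    \<comment> \<open>The symbols prescribed in later rows. A symbol outside \<open>Z\<close> is
      blocked by the earlier rows only, hence in at most \<open>k\<close> columns.\<close>
    define Z where "Z = g ` Sigma {k<..<t} A"
    have finSig: "finite (Sigma {k<..<t} A)"
      using finA by auto
    have cardZ: "card Z \<le> (\<Sum>i\<in>{k<..<t}. card (A i))"
    proof -
      have "card Z \<le> card (Sigma {k<..<t} A)"
        unfolding Z_def using finSig by (rule card_image_le)
      also have "\<dots> = (\<Sum>i\<in>{k<..<t}. card (A i))"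
        using finA by (simp add: card_SigmaI)
      finally show ?thesis .
    qed
    \<comment> \<open>The columns in which the earlier rows contain \<open>y\<close>, one for each
      of them.\<close>
    define P where "P y = (\<lambda>i. inv_into {..<n} (L i) y) ` {..<k}" for y
    have P: "card (P y) \<le> k" "finite (P y)" for y
      using card_image_le [of "{..<k}"] by (auto simp: P_def)
    have inP: "x \<in> P y" if "x \<in> X" "i < k" "L i x = y" for x y i
    proof -
      have "x \<in> {..<n}"
        using that(1) XY(1) by (auto simp: C_def)
      then have "inv_into {..<n} (L i) y = x"
        using latin_rows_bij [OF L, of i] that by (auto simp: bij_betw_def)
      then show ?thesis
        using that(2) by (auto simp: P_def)
    qed
    have X1: "card X \<le> k" if "y \<in> Y" "y \<notin> Z" for y
    proof -
      have "X \<subseteq> P y"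
      proof
        fix x assume x: "x \<in> X"
        then have "F x y"
          using XY(5) that(1) by blast
        moreover have "g (i, x) \<noteq> y" if "k < i" "i < t" "x \<in> A i" for i
          using that \<open>y \<notin> Z\<close> by (force simp: Z_def)
        ultimately show "x \<in> P y"
          using inP [OF x] by (auto simp: F_def)
      qed
      then show ?thesis
        using P [of y] card_mono [of "P y" X] by linarith
    qed
    have X2: "card X \<le> k + 1"
    proof -
      obtain y where y: "y \<in> Y"
        using XY(4) by blast
      show ?thesis
      proof (cases "y \<in> Z")
        case True
        then obtain i j where ij: "k < i" "i < t" "j \<in> A i" "y = g (i, j)"
          by (auto simp: Z_def)
        have "X \<subseteq> insert j (P y)"
        proof
          fix x assume x: "x \<in> X"
          then have "F x y"
            using XY(5) y by blast
          moreover have "x = j" if "k < i'" "i' < t" "x \<in> A i'" "g (i', x) = y" for i'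
            using gD [of i' x i j] that ij by simp
          ultimately show "x \<in> insert j (P y)"
            using inP [OF x] by (auto simp: F_def)
        qed
        then have "card X \<le> card (insert j (P y))"
          using P(2) by (intro card_mono) auto
        also have "\<dots> \<le> k + 1"
          using P(1) [of y] P(2) [of y] by (simp add: card_insert_if)
        finally show ?thesis .
      next
        case False
        then show ?thesis
          using X1 [OF y] by simp
      qed
    qed
    \<comment> \<open>The bounds \<open>card X \<le> k + 1\<close> and
      \<open>card Y \<le> t - 1\<close> settle \<open>wide\<close>. The other two cases have to save
      one. In \<open>few\<close>, either \<open>Y\<close> lies in the small set \<open>Z\<close> or
      some symbol of \<open>Y\<close> outside \<open>Z\<close> gives \<open>card X \<le> k\<close>;
      in \<open>gap\<close>, a column of \<open>X\<close> has a later row prescribing nothing there,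
      so \<open>card Y \<le> t - 2\<close>.\<close>
    consider (wide) "card (A k) + t + k \<le> n"
      | (few) "card (A k) + t + k \<le> n + 1" "(\<Sum>i\<in>{k<..<t}. card (A i)) + 1 < t"
      | (gap) "card (A k) + t + k \<le> n + 1" "\<forall>x<n. x \<notin> A k \<longrightarrow> (\<exists>i. k < i \<and> i < t \<and> x \<notin> A i)"
      using cond by blast
    then have "card X + card Y + card (A k) \<le> n"
    proof cases
      case wide
      then show ?thesis
        using X2 Y1 by linarith
    next
      case few
      show ?thesis
      proof (cases "Y \<subseteq> Z")
        case True
        then have "card Y \<le> card Z"
          using finSig by (auto simp: Z_def intro: card_mono)
        then show ?thesis
          using few cardZ X2 by linarith
      next
        case False
        then show ?thesis
          using few X1 Y1 by fastforce
      qed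
    next
      case gap
      have "x0 < n" "x0 \<notin> A k"
        using x0 XY(1) by (auto simp: C_def)
      then obtain i where "k < i" "i < t" "x0 \<notin> A i"
        using gap(2) by blast
      then show ?thesis
        using Y2 [OF x0] gap(1) X2 by fastforce
    qed
    then show "card X + card Y \<le> card C"
      using cardC by simp
  qed (use cardC cardS in \<open>auto simp: C_def S_def\<close>)
  then obtain h0 where h0: "bij_betw h0 C S" "\<forall>x\<in>C. \<not> F x (h0 x)"
    by blast
  define h where "h j = (if j \<in> A k then g (k, j) else h0 j)" for j
  have "bij_betw h (A k) G"
    using gk by (auto simp: bij_betw_def G_def h_def inj_on_def)
  moreover have "bij_betw h C S"
    using h0(1) by (rule bij_betw_cong [THEN iffD1, rotated]) (auto simp: h_def C_def)
  ultimately have "bij_betw h (A k \<union> C) (G \<union> S)"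
    by (rule bij_betw_combine) (auto simp: S_def)
  moreover have "A k \<union> C = {..<n}" "G \<union> S = {..<n}"
    using A [OF k] Gn by (auto simp: C_def S_def)
  ultimately have "bij_betw h {..<n} {..<n}"
    by simp
  moreover have "\<forall>j\<in>A k. h j = g (k, j)"
    by (simp add: h_def)
  moreover have "L i j \<noteq> h j" if "j < n" "i < k" for i j
  proof (cases "j \<in> A k")
    case True
    then show ?thesis
      using later [of i k j] that k by (simp add: h_def)
  next
    case False
    then have "\<not> F j (h0 j)"
      using h0(2) that by (auto simp: C_def)
    then show ?thesis
      using that False by (auto simp: h_def F_def)
  qed
  moreover have "h j \<noteq> g (i', j)" if "k < i'" "i' < t" "j \<in> A i'" for i' j
  proof (cases "j \<in> A k")
    case True
    then show ?thesis
      using gD [of k j i' j] that k by (auto simp: h_def)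
  next
    case False
    then have "\<not> F j (h0 j)"
      using h0(2) A [OF that(2)] that(3) by (auto simp: C_def)
    then show ?thesis
      using that False by (auto simp: h_def F_def)
  qed
  ultimately show ?thesis
    by blast
qed

text \<open>The last conjunct is the induction invariant: no completed row anticipates a symbol that
  a later row prescribes in the same column. It makes the prescribed entries of the next row
  admissible.\<close>

lemma latin_rows_prefill:
  fixes g :: "nat \<times> nat \<Rightarrow> nat"
  assumes A: "\<And>i. i < t \<Longrightarrow> A i \<subseteq> {..<n}"
    and g: "inj_on g (Sigma {..<t} A)" "g ` Sigma {..<t} A \<subseteq> {..<n}"
    and cond: "\<And>k. k < t \<Longrightarrow> card (A k) + t + k \<le> n \<or> card (A k) + t + k \<le> n + 1 \<and>
      ((\<Sum>i\<in>{k<..<t}. card (A i)) + 1 < t \<or> (\<forall>x<n. x \<notin> A k \<longrightarrow> (\<exists>i. k < i \<and> i < t \<and> x \<notin> A i)))"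
    and "k \<le> t"
  shows "\<exists>L. latin_rows n {..<k} L \<and> (\<forall>i<k. \<forall>j\<in>A i. L i j = g (i, j)) \<and>
    (\<forall>i<k. \<forall>i'. k \<le> i' \<longrightarrow> i' < t \<longrightarrow> (\<forall>j\<in>A i'. L i j \<noteq> g (i', j)))"
  using \<open>k \<le> t\<close>
proof (induction k)
  case 0
  then show ?case
    by (simp add: latin_rows_def)
next
  case (Suc k)
  then obtain L where L: "latin_rows n {..<k} L" "\<forall>i<k. \<forall>j\<in>A i. L i j = g (i, j)"
    "\<forall>i<k. \<forall>i'. k \<le> i' \<longrightarrow> i' < t \<longrightarrow> (\<forall>j\<in>A i'. L i j \<noteq> g (i', j))"
    by auto
  have k: "k < t"
    using Suc.prems by simp
  have "\<exists>h. bij_betw h {..<n} {..<n} \<and> (\<forall>j\<in>A k. h j = g (k, j)) \<and>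
    (\<forall>j<n. \<forall>i<k. L i j \<noteq> h j) \<and> (\<forall>i'. k < i' \<longrightarrow> i' < t \<longrightarrow> (\<forall>j\<in>A i'. h j \<noteq> g (i', j)))"
    using latin_rows_prefill_step [OF L(1) k A g _ cond [OF k]] L(3) by blast
  then obtain h where h: "bij_betw h {..<n} {..<n}" "\<forall>j\<in>A k. h j = g (k, j)"
    "\<forall>j<n. \<forall>i<k. L i j \<noteq> h j" "\<forall>i'. k < i' \<longrightarrow> i' < t \<longrightarrow> (\<forall>j\<in>A i'. h j \<noteq> g (i', j))"
    by blast
  have lt: "i < Suc k \<longleftrightarrow> i < k \<or> i = k" for i
    by auto
  have "latin_rows n {..<Suc k} (L(k := h))"
    using L(1) h(1,3) unfolding latin_rows_def by (auto simp: lt eq_commute)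
  moreover have "\<forall>i<Suc k. \<forall>j\<in>A i. (L(k := h)) i j = g (i, j)"
    using L(2) h(2) by (auto simp: lt)
  moreover have "\<forall>i<Suc k. \<forall>i'. Suc k \<le> i' \<longrightarrow> i' < t \<longrightarrow> (\<forall>j\<in>A i'. (L(k := h)) i j \<noteq> g (i', j))"
    using L(3) h(4) by (auto simp: lt)
  ultimately show ?case
    by blast
qed

text \<open>At most \<open>n\<close> cells are selected, so distinct symbols can be prescribed on
  them. The filling works with rows numbered from 0 in the order of processing;
  \<open>\<rho>\<close> moves them to their places in the array before the extension to a Latin
  square.\<close>

lemma latin_square_rainbow:
  assumes A: "\<And>i. i < t \<Longrightarrow> A i \<subseteq> {..<n}" and total: "(\<Sum>i<t. card (A i)) \<le> n"
    and \<rho>: "inj_on \<rho> {..<t}" "\<rho> ` {..<t} \<subseteq> {..<n}"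
    and cond: "\<And>k. k < t \<Longrightarrow> card (A k) + t + k \<le> n \<or> card (A k) + t + k \<le> n + 1 \<and>
      ((\<Sum>i\<in>{k<..<t}. card (A i)) + 1 < t \<or> (\<forall>x<n. x \<notin> A k \<longrightarrow> (\<exists>i. k < i \<and> i < t \<and> x \<notin> A i)))"
  shows "\<exists>L. latin_rows n {..<n} L \<and> inj_on (\<lambda>(i, j). L (\<rho> i) j) (Sigma {..<t} A)"
proof -
  have finA: "finite (A i)" if "i < t" for i
    using A [OF that] finite_subset by blast
  have "card (Sigma {..<t} A) \<le> card {..<n}"
    using total finA by (simp add: card_SigmaI)
  moreover have "finite (Sigma {..<t} A)"
    using finA by auto
  ultimately obtain g where g: "inj_on g (Sigma {..<t} A)" "g ` Sigma {..<t} A \<subseteq> {..<n}"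
    using card_le_inj [of "Sigma {..<t} A" "{..<n}"] by auto
  obtain L where L: "latin_rows n {..<t} L" "\<forall>i<t. \<forall>j\<in>A i. L i j = g (i, j)"
    using latin_rows_prefill [OF A g cond le_refl] by blast
  define M where "M i = L (inv_into {..<t} \<rho> i)" for i
  have M: "M (\<rho> i) = L i" if "i < t" for i
    using \<rho>(1) that by (simp add: M_def)
  have "latin_rows n (\<rho> ` {..<t}) M"
    using L(1) M unfolding latin_rows_def by auto (metis lessThan_iff)
  then obtain N where N: "latin_rows n {..<n} N" "\<forall>k\<in>\<rho> ` {..<t}. N k = M k"
    using latin_rows_extend [OF _ \<rho>(2)] by blast
  have "inj_on (\<lambda>(i, j). N (\<rho> i) j) (Sigma {..<t} A) \<longleftrightarrow> inj_on g (Sigma {..<t} A)"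
    using N(2) M L(2) by (intro inj_on_cong) auto
  then show ?thesis
    using N(1) g(1) by blast
qed

section \<open>Two-colored arrays\<close>

text \<open>A coloring is a predicate \<open>c\<close> that holds on the red cells, so negating it
  exchanges the colors and each lemma below can be used for either color.\<close>

definition row_set :: "nat \<Rightarrow> (nat \<Rightarrow> nat \<Rightarrow> bool) \<Rightarrow> nat \<Rightarrow> nat set" where
  "row_set n c i = {j. j < n \<and> c i j}"

definition hits_all :: "nat \<Rightarrow> (nat \<Rightarrow> nat \<Rightarrow> bool) \<Rightarrow> (nat \<Rightarrow> nat \<Rightarrow> nat) \<Rightarrow> bool" where
  "hits_all n c L \<longleftrightarrow> (\<forall>s<n. \<exists>i<n. \<exists>j<n. c i j \<and> L i j = s)"

definition solvable :: "nat \<Rightarrow> (nat \<Rightarrow> nat \<Rightarrow> bool) \<Rightarrow> bool" where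
  "solvable n c \<longleftrightarrow> (\<exists>L. latin_rows n {..<n} L \<and> hits_all n c L \<and> hits_all n (\<lambda>i j. \<not> c i j) L)"

lemma finite_row_set [simp]: "finite (row_set n c i)"
  by (simp add: row_set_def)

lemma row_set_subset: "row_set n c i \<subseteq> {..<n}"
  by (auto simp: row_set_def)

lemma card_row_set_le: "card (row_set n c i) \<le> n"
  using card_mono [OF finite_lessThan row_set_subset] by simp

lemma card_row_set_not: "card (row_set n (\<lambda>i j. \<not> c i j) i) = n - card (row_set n c i)"
proof -
  have "row_set n (\<lambda>i j. \<not> c i j) i = {..<n} - row_set n c i"
    by (auto simp: row_set_def)
  then show ?thesis
    using row_set_subset [of n c i] by (simp add: card_Diff_subset)
qed

lemma solvable_not: "solvable n (\<lambda>i j. \<not> c i j) \<longleftrightarrow> solvable n c"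
  by (auto simp: solvable_def)

lemma latin_rows_obtain:
  assumes "latin_rows n {..<n} L" "i < n" "s < n"
  obtains j where "j < n" "L i j = s"
proof -
  have "s \<in> L i ` {..<n}"
    using latin_rows_bij [OF assms(1), of i] assms(2,3) by (simp add: bij_betw_def)
  then show thesis
    using that by auto
qed

lemma hits_all_full_row:
  assumes "latin_rows n {..<n} L" "i < n" "\<And>j. j < n \<Longrightarrow> c i j"
  shows "hits_all n c L"
  unfolding hits_all_def
proof (intro allI impI)
  fix s assume "s < n"
  then obtain j where "j < n" "L i j = s"
    using latin_rows_obtain [OF assms(1,2)] by blast
  then show "\<exists>i<n. \<exists>j<n. c i j \<and> L i j = s"
    using assms(2,3) by blast
qed

lemma latin_rows_exist: "\<exists>L. latin_rows n {..<n} L"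
  using latin_rows_extend [of n "{}"] by (auto simp: latin_rows_def)

text \<open>The \<open>n\<close> selected red cells carry \<open>n\<close> distinct symbols, hence
  all of them. If two rows have all their red cells selected, a symbol red in both would occur on
  two selected cells; so one of its occurrences in these rows is blue.\<close>

lemma rainbow_hits_all:
  fixes c :: "nat \<Rightarrow> nat \<Rightarrow> bool"
  assumes A: "\<And>i. i < t \<Longrightarrow> A i \<subseteq> row_set n c (\<rho> i)" and total: "(\<Sum>i<t. card (A i)) = n"
    and \<rho>: "inj_on \<rho> {..<t}" "\<rho> ` {..<t} \<subseteq> {..<n}"
    and cond: "\<And>k. k < t \<Longrightarrow> card (A k) + t + k \<le> n \<or> card (A k) + t + k \<le> n + 1 \<and>
      ((\<Sum>i\<in>{k<..<t}. card (A i)) + 1 < t \<or> (\<forall>x<n. x \<notin> A k \<longrightarrow> (\<exists>i. k < i \<and> i < t \<and> x \<notin> A i)))"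
  shows "\<exists>L. latin_rows n {..<n} L \<and> hits_all n c L \<and>
    ((\<exists>k<t. \<exists>k'<t. k \<noteq> k' \<and> A k = row_set n c (\<rho> k) \<and> A k' = row_set n c (\<rho> k'))
      \<longrightarrow> hits_all n (\<lambda>i j. \<not> c i j) L)"
proof -
  have An: "A i \<subseteq> {..<n}" if "i < t" for i
    using A [OF that] row_set_subset by blast
  then have finA: "finite (A i)" if "i < t" for i
    using that finite_subset by blast
  have "\<exists>L. latin_rows n {..<n} L \<and> inj_on (\<lambda>(i, j). L (\<rho> i) j) (Sigma {..<t} A)"
    by (rule latin_square_rainbow [OF An _ \<rho> cond]) (simp_all add: total)
  then obtain L where L: "latin_rows n {..<n} L" "inj_on (\<lambda>(i, j). L (\<rho> i) j) (Sigma {..<t} A)"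
    by blast
  let ?G = "(\<lambda>(i, j). L (\<rho> i) j) ` Sigma {..<t} A"
  have \<rho>n: "\<rho> i < n" if "i < t" for i
    using \<rho>(2) that by auto
  have "L (\<rho> i) j < n" if "i < t" "j \<in> A i" for i j
    using bij_betwE [OF latin_rows_bij [OF L(1)], of "\<rho> i"] \<rho>n [OF that(1)] An [OF that(1)] that(2)
    by blast
  then have "?G \<subseteq> {..<n}"
    by auto
  moreover have "card ?G = n"
    using L(2) total finA by (simp add: card_image card_SigmaI)
  ultimately have G: "?G = {..<n}"
    by (simp add: card_subset_eq)
  have "hits_all n c L"
    unfolding hits_all_def
  proof (intro allI impI)
    fix s assume "s < n"
    then have "s \<in> ?G"
      using G by simp
    then obtain i j where "i < t" "j \<in> A i" "L (\<rho> i) j = s"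
      by auto
    then show "\<exists>i<n. \<exists>j<n. c i j \<and> L i j = s"
      using A [of i] \<rho>n [of i] by (auto simp: row_set_def)
  qed
  moreover have "hits_all n (\<lambda>i j. \<not> c i j) L"
    if k: "k < t" "k' < t" "k \<noteq> k'" "A k = row_set n c (\<rho> k)" "A k' = row_set n c (\<rho> k')" for k k'
    unfolding hits_all_def
  proof (intro allI impI)
    fix s assume s: "s < n"
    obtain j where j: "j < n" "L (\<rho> k) j = s"
      using latin_rows_obtain [OF L(1) \<rho>n [OF k(1)] s] .
    obtain j' where j': "j' < n" "L (\<rho> k') j' = s"
      using latin_rows_obtain [OF L(1) \<rho>n [OF k(2)] s] .
    have "\<not> (j \<in> A k \<and> j' \<in> A k')"
      using inj_onD [OF L(2), of "(k, j)" "(k', j')"] j j' k(1-3) by auto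
    then have "\<not> c (\<rho> k) j \<or> \<not> c (\<rho> k') j'"
      using j(1) j'(1) k(4,5) by (simp add: row_set_def)
    then show "\<exists>i<n. \<exists>j<n. \<not> c i j \<and> L i j = s"
      using j j' \<rho>n [OF k(1)] \<rho>n [OF k(2)] by blast
  qed
  ultimately show ?thesis
    using L(1) by blast
qed

section \<open>Selecting red cells from the rows with the most red cells\<close>

lemma descending_enumeration:
  fixes d :: "nat \<Rightarrow> nat"
  shows "\<exists>\<rho>. bij_betw \<rho> {..<n} {..<n} \<and> (\<forall>j<n. \<forall>i\<le>j. d (\<rho> j) \<le> d (\<rho> i))"
proof -
  define xs where "xs = sort_key (\<lambda>i. - int (d i)) [0..<n]"
  have len: "length xs = n"
    by (simp add: xs_def)
  have set: "set xs = {..<n}" and dist: "distinct xs"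
    by (auto simp: xs_def)
  have "bij_betw ((!) xs) {..<n} {..<n}"
    by (rule bij_betw_nth [OF dist]) (simp_all add: len set)
  moreover have "sorted (map (\<lambda>i. - int (d i)) xs)"
    unfolding xs_def by (rule sorted_sort_key)
  then have "map (\<lambda>i. - int (d i)) xs ! i \<le> map (\<lambda>i. - int (d i)) xs ! j" if "i \<le> j" "j < n" for i j
    by (rule sorted_nth_mono) (use that len in simp_all)
  then have "d (xs ! j) \<le> d (xs ! i)" if "i \<le> j" "j < n" for i j
    using that len by fastforce
  ultimately show ?thesis
    by blast
qed

text \<open>Rows are taken in descending order of red cells until \<open>n\<close> cells are
  available, the last row only in part. Its first conclusion serves when some row is entirely blue,
  its second when any two rows together have fewer than \<open>n\<close> red cells.\<close>

lemma greedy_rows: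
  fixes n :: nat and c :: "nat \<Rightarrow> nat \<Rightarrow> bool"
  defines "d i \<equiv> card (row_set n c i)"
  assumes n: "n \<ge> 7" and total: "(\<Sum>i<n. d i) \<ge> 2 * n - 1" and lt: "\<And>i. i < n \<Longrightarrow> d i < n"
  shows "\<exists>L. latin_rows n {..<n} L \<and> hits_all n c L \<and>
    ((\<forall>i<n. \<forall>j<n. i \<noteq> j \<longrightarrow> d i + d j < n) \<longrightarrow> hits_all n (\<lambda>i j. \<not> c i j) L)"
proof -
  obtain \<rho> where \<rho>: "bij_betw \<rho> {..<n} {..<n}"
    and desc: "\<And>i j. \<lbrakk>i \<le> j; j < n\<rbrakk> \<Longrightarrow> d (\<rho> j) \<le> d (\<rho> i)"
    using descending_enumeration [of n d] by blast
  define e where "e k = d (\<rho> k)" for k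
  define S where "S t = (\<Sum>k<t. e k)" for t
  have \<rho>n: "\<rho> k < n" if "k < n" for k
    using bij_betwE [OF \<rho>] that by simp
  have Sn: "S n \<ge> 2 * n - 1"
    using sum.reindex_bij_betw [OF \<rho>, of d] total by (simp add: S_def e_def)
  \<comment> \<open>The number of rows used. Row \<open>m = t - 1\<close> is the one taken in part;
    \<open>m \<ge> 1\<close> because no row is entirely red.\<close>
  define t where "t = (LEAST t. n \<le> S t)"
  have "n \<le> S n"
    using Sn n by simp
  then have St: "n \<le> S t" and tn: "t \<le> n"
    unfolding t_def by (auto intro: LeastI Least_le)
  have "t \<noteq> 0"
    using St n by (auto simp: S_def intro: ccontr)
  then obtain m where m: "t = Suc m"
    using not0_implies_Suc by blast
  have Sm: "S m < n"
    using not_less_Least [of m "\<lambda>t. n \<le> S t"] m by (simp add: t_def)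
  have m1: "m \<ge> 1"
  proof (rule ccontr)
    assume "\<not> m \<ge> 1"
    then have "m = 0"
      by simp
    then have "S t = e 0"
      using m by (simp add: S_def)
    then show False
      using St lt [OF \<rho>n [of 0]] n by (simp add: e_def)
  qed
  have mn: "m < n"
    using m tn by simp
  \<comment> \<open>If the rows from \<open>m\<close> on had at most one red cell each, the total
    would be at most \<open>(n - 1) + (n - m) \<le> 2 * n - 2\<close>. This is where the bound
    \<open>2 * n - 1\<close> enters.\<close>
  have em: "e m \<ge> 2"
  proof (rule ccontr)
    assume "\<not> e m \<ge> 2"
    then have le1: "e k \<le> 1" if "m \<le> k" "k < n" for k
      using desc [of m k] that by (simp add: e_def)
    have "S n = S m + (\<Sum>k\<in>{m..<n}. e k)"
      unfolding S_def using mn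
      by (metis atLeast0LessThan less_imp_le_nat sum.atLeastLessThan_concat zero_le)
    also have "(\<Sum>k\<in>{m..<n}. e k) \<le> (\<Sum>k\<in>{m..<n}. 1)"
      using le1 by (intro sum_mono) auto
    finally show False
      using Sn Sm m1 mn by simp
  qed
  have e2: "e k \<ge> 2" if "k \<le> m" for k
    using desc [OF that mn] em by (simp add: e_def)
  \<comment> \<open>The first \<open>k + 1\<close> rows have at least \<open>e k\<close> red cells
    each, the remaining ones before \<open>m\<close> at least 2.\<close>
  have bound: "e k * Suc k + 2 * (m - Suc k) \<le> S m" if "k < m" for k
  proof -
    have "S m = (\<Sum>i<Suc k. e i) + (\<Sum>i\<in>{Suc k..<m}. e i)"
      unfolding S_def using that
      by (metis Suc_leI atLeast0LessThan sum.atLeastLessThan_concat zero_le)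
    moreover have "(\<Sum>i<Suc k. e k) \<le> (\<Sum>i<Suc k. e i)"
      using that mn by (intro sum_mono) (auto simp: e_def intro: desc)
    moreover have "(\<Sum>i\<in>{Suc k..<m}. 2) \<le> (\<Sum>i\<in>{Suc k..<m}. e i)"
      using e2 by (intro sum_mono) auto
    ultimately show ?thesis
      by (simp add: mult.commute)
  qed
  have "(\<Sum>k<m. 2) \<le> S m"
    unfolding S_def using e2 by (intro sum_mono) simp
  then have S2: "2 * m \<le> S m"
    by simp
  have cardrow: "card (row_set n c (\<rho> k)) = e k" for k
    by (simp add: e_def d_def)
  have rest: "n - S m \<le> e m"
    using St m by (simp add: S_def)
  \<comment> \<open>If the first row alone has \<open>n - 1\<close> red cells, a single cell is
    missing. It is taken outside the column of the blue cell of that row, so that the third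
    alternative of the filling condition holds for the first row.\<close>
  have "\<exists>B\<subseteq>row_set n c (\<rho> m). card B = n - S m \<and>
    (m = 1 \<longrightarrow> e 0 = n - 1 \<longrightarrow> (\<forall>x<n. x \<notin> row_set n c (\<rho> 0) \<longrightarrow> x \<notin> B))"
  proof (cases "m = 1 \<and> e 0 = n - 1")
    case True
    have "card ({..<n} - row_set n c (\<rho> 0)) = 1"
      using True n cardrow [of 0] row_set_subset by (simp add: card_Diff_subset)
    then obtain p where p: "{..<n} - row_set n c (\<rho> 0) = {p}"
      by (meson card_1_singletonE)
    have "\<not> row_set n c (\<rho> m) \<subseteq> {p}"
      using em cardrow [of m] card_mono [of "{p}" "row_set n c (\<rho> m)"] by auto
    then obtain x where x: "x \<in> row_set n c (\<rho> m)" "x \<noteq> p"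
      by blast
    have "n - S m = 1"
      using True n by (simp add: S_def)
    then show ?thesis
      using x p by (intro exI [of _ "{x}"]) auto
  next
    case False
    then show ?thesis
      using obtain_subset_with_card_n [of "n - S m" "row_set n c (\<rho> m)"] rest cardrow by metis
  qed
  then obtain B where B: "B \<subseteq> row_set n c (\<rho> m)" "card B = n - S m"
    "m = 1 \<Longrightarrow> e 0 = n - 1 \<Longrightarrow> \<forall>x<n. x \<notin> row_set n c (\<rho> 0) \<longrightarrow> x \<notin> B"
    by blast
  define A where "A k = (if k < m then row_set n c (\<rho> k) else B)" for k
  have cardA: "card (A k) = (if k < m then e k else n - S m)" for k
    using B(2) cardrow by (simp add: A_def)
  have "\<exists>L. latin_rows n {..<n} L \<and> hits_all n c L \<and>
    ((\<exists>k<t. \<exists>k'<t. k \<noteq> k' \<and> A k = row_set n c (\<rho> k) \<and> A k' = row_set n c (\<rho> k'))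
      \<longrightarrow> hits_all n (\<lambda>i j. \<not> c i j) L)"
  proof (rule rainbow_hits_all)
    show "A i \<subseteq> row_set n c (\<rho> i)" if "i < t" for i
      using that B(1) m by (cases "i = m") (auto simp: A_def)
    have "(\<Sum>i<t. card (A i)) = (\<Sum>i<m. e i) + (n - S m)"
      using m cardA by simp
    then show "(\<Sum>i<t. card (A i)) = n"
      using Sm by (simp add: S_def)
    show "inj_on \<rho> {..<t}"
      using \<rho> tn by (auto simp: bij_betw_def intro: inj_on_subset)
    show "\<rho> ` {..<t} \<subseteq> {..<n}"
      using \<rho>n tn by auto
  next
    fix k assume "k < t"
    then consider "k = m" | "k < m"
      using m by linarith
    then show "card (A k) + t + k \<le> n \<or> card (A k) + t + k \<le> n + 1 \<and>
      ((\<Sum>i\<in>{k<..<t}. card (A i)) + 1 < t \<or> (\<forall>x<n. x \<notin> A k \<longrightarrow> (\<exists>i. k < i \<and> i < t \<and> x \<notin> A i)))"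
    proof cases
      case 1
      \<comment> \<open>For the last row no later row remains, so the second alternative holds:
        \<open>n - S m + 2 * m + 1 \<le> n + 1\<close> because
        \<open>2 * m \<le> S m\<close>.\<close>
      then have "{k<..<t} = {}"
        using m by auto
      moreover have "card (A k) + t + k \<le> n + 1"
        using 1 m S2 Sm cardA [of m] by (simp; arith)
      ultimately show ?thesis
        using m m1 by simp
    next
      case 2
      define r where "r = e k"
      define u where "u = m - Suc k"
      have b: "r * Suc k + 2 * u \<le> S m"
        using bound [OF 2] by (simp add: r_def u_def)
      have mk: "m = Suc k + u"
        using 2 by (simp add: u_def)
      have cA: "card (A k) = r"
        using 2 cardA by (simp add: r_def)
      have r2: "r \<ge> 2"
        using e2 [of k] 2 by (simp add: r_def)
      have goal: "r + t + k = r + 2 * k + u + 2"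
        using m mk by simp
      \<comment> \<open>Here \<open>b\<close> and \<open>Sm\<close> bound
        \<open>r * Suc k + 2 * u\<close> by \<open>n - 1\<close>, and
        \<open>r + 2 * k + u + 2\<close> should be at most \<open>n\<close>. Only the first and the
        fourth case can exceed this, and then by one.\<close>
      consider "k = 0" "u = 0" "r = n - 1" | "k = 0" "u > 0 \<or> r \<noteq> n - 1"
        | "k \<ge> 1" "r = 2" "u \<ge> 1" | "k \<ge> 1" "r = 2" "u = 0" | "k \<ge> 1" "r \<ge> 3"
        using r2 by linarith
      then show ?thesis
      proof cases
        case 1
        have "\<forall>x<n. x \<notin> A k \<longrightarrow> (\<exists>i. k < i \<and> i < t \<and> x \<notin> A i)"
        proof (intro allI impI)
          fix x assume "x < n" "x \<notin> A k"
          then have "x \<notin> A m"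
            using B(3) 1 mk by (simp add: A_def r_def)
          then show "\<exists>i. k < i \<and> i < t \<and> x \<notin> A i"
            using 2 m by blast
        qed
        moreover have "card (A k) + t + k \<le> n + 1"
          using 1 goal cA n by simp
        ultimately show ?thesis
          by blast
      next
        case 2
        then have "r + 2 * u \<le> n - 1"
          using b Sm by simp
        then have "r + t + k \<le> n"
          using 2 goal n by auto
        then show ?thesis
          using cA by simp
      next
        case 3
        then have "r + t + k \<le> n"
          using b Sm goal by simp
        then show ?thesis
          using cA by simp
      next
        case 4
        \<comment> \<open>If the bound \<open>n\<close> is exceeded, then
          \<open>S m = n - 1\<close>, so the last row contributes one cell only. As
          \<open>t \<ge> 3\<close>, the second alternative applies.\<close>
        have "{k<..<t} = {m}"
          using m mk 4 by auto
        then have "(\<Sum>i\<in>{k<..<t}. card (A i)) = n - S m"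
          using cardA by simp
        moreover have "r + t + k \<le> n + 1"
          using 4 b Sm goal by simp
        ultimately show ?thesis
          using cA 4 b Sm n m mk by (cases "r + t + k \<le> n") auto
      next
        case 5
        then obtain a b' where ab: "r = 3 + a" "k = Suc b'"
          by (metis One_nat_def Suc_le_D le_Suc_ex)
        have "r * Suc k \<ge> 6 + 3 * b' + 2 * a"
          using ab by (simp add: algebra_simps)
        then have "6 + 3 * b' + 2 * a + 2 * u \<le> S m"
          using b by linarith
        then have "r + t + k \<le> n"
          using Sm goal ab by simp
        then show ?thesis
          using cA by simp
      qed
    qed
  qed
  then obtain L where L: "latin_rows n {..<n} L" "hits_all n c L"
    "(\<exists>k<t. \<exists>k'<t. k \<noteq> k' \<and> A k = row_set n c (\<rho> k) \<and> A k' = row_set n c (\<rho> k'))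
      \<longrightarrow> hits_all n (\<lambda>i j. \<not> c i j) L"
    by blast
  \<comment> \<open>The two richest rows do not reach \<open>n\<close> red cells, so at least three
    rows are used and the first two are selected completely.\<close>
  have "hits_all n (\<lambda>i j. \<not> c i j) L" if sparse: "\<forall>i<n. \<forall>j<n. i \<noteq> j \<longrightarrow> d i + d j < n"
  proof -
    have "\<rho> 0 \<noteq> \<rho> 1"
      using inj_onD [OF bij_betw_imp_inj_on [OF \<rho>], of 0 1] n by auto
    then have "e 0 + e 1 < n"
      using sparse \<rho>n [of 0] \<rho>n [of 1] n by (simp add: e_def)
    then have "m \<noteq> 1"
      using St m by (auto simp: S_def)
    then have "0 < t \<and> 1 < t \<and> (0::nat) \<noteq> 1 \<and> A 0 = row_set n c (\<rho> 0) \<and> A 1 = row_set n c (\<rho> 1)"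
      using m m1 by (simp add: A_def)
    then show ?thesis
      using L(3) by blast
  qed
  then show ?thesis
    using L(1,2) by blast
qed

section \<open>Selections from two or three rows\<close>

text \<open>All red cells of both rows are selected, row \<open>i\<close> being filled first. If it
  has only one blue cell, the containment in \<open>alt\<close> keeps row \<open>j\<close> from
  prescribing anything in the column of that cell.\<close>

lemma solvable_pair:
  assumes ij: "i < n" "j < n" "i \<noteq> j"
    and d: "card (row_set n c i) + card (row_set n c j) = n" "card (row_set n c i) < n"
      "card (row_set n c j) + 2 \<le> n"
    and alt: "card (row_set n c i) + 2 \<le> n \<or> (\<forall>x<n. c j x \<longrightarrow> c i x)"
  shows "solvable n c"
proof -
  define \<rho> where "\<rho> k = (if k = 0 then i else j)" for k :: nat
  define A where "A k = row_set n c (\<rho> k)" for k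
  have two: "k < 2 \<longleftrightarrow> k = 0 \<or> k = 1" for k :: nat
    by auto
  have ivl: "{..<2::nat} = {0, 1}" "{0<..<2::nat} = {1}" "{1<..<2::nat} = {}"
    by auto
  have "\<exists>L. latin_rows n {..<n} L \<and> hits_all n c L \<and>
    ((\<exists>k<2. \<exists>k'<2. k \<noteq> k' \<and> A k = row_set n c (\<rho> k) \<and> A k' = row_set n c (\<rho> k'))
      \<longrightarrow> hits_all n (\<lambda>i j. \<not> c i j) L)"
  proof (rule rainbow_hits_all)
    show "(\<Sum>k<2. card (A k)) = n"
      using d by (simp add: ivl A_def \<rho>_def)
    show "inj_on \<rho> {..<2}" "\<rho> ` {..<2} \<subseteq> {..<n}"
      using ij by (auto simp: ivl \<rho>_def)
  next
    fix k :: nat assume "k < 2"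
    then consider "k = 0" | "k = 1"
      by linarith
    then show "card (A k) + 2 + k \<le> n \<or> card (A k) + 2 + k \<le> n + 1 \<and>
      ((\<Sum>i\<in>{k<..<2}. card (A i)) + 1 < 2 \<or> (\<forall>x<n. x \<notin> A k \<longrightarrow> (\<exists>i. k < i \<and> i < 2 \<and> x \<notin> A i)))"
    proof cases
      case 1
      have "\<forall>x<n. x \<notin> A 0 \<longrightarrow> (\<exists>i. 0 < i \<and> i < 2 \<and> x \<notin> A i)" if "\<forall>x<n. c j x \<longrightarrow> c i x"
        using that by (auto simp: A_def \<rho>_def row_set_def intro!: exI [of _ 1])
      moreover have "card (A 0) + 2 + 0 \<le> n + 1"
        using d by (simp add: A_def \<rho>_def)
      moreover have "card (A 0) + 2 + 0 \<le> n \<or> (\<forall>x<n. c j x \<longrightarrow> c i x)"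
        using alt by (simp add: A_def \<rho>_def)
      ultimately show ?thesis
        unfolding 1 by blast
    next
      case 2
      then show ?thesis
        using d by (simp add: ivl A_def \<rho>_def)
    qed
  qed (simp add: A_def)
  moreover have "(0::nat) < 2 \<and> (1::nat) < 2 \<and> (0::nat) \<noteq> 1"
    by simp
  ultimately show ?thesis
    unfolding solvable_def A_def by blast
qed

text \<open>Rows \<open>i\<close> and \<open>k\<close> are selected completely, and a part
  \<open>B\<close> of row \<open>j\<close> supplies the missing cells. The rows are filled in the
  order \<open>i\<close>, \<open>j\<close>, \<open>k\<close>.\<close>

lemma solvable_triple:
  fixes n :: nat and c :: "nat \<Rightarrow> nat \<Rightarrow> bool"
  defines "d i \<equiv> card (row_set n c i)"
  assumes n: "n \<ge> 7" and ijk: "i < n" "j < n" "k < n" "i \<noteq> j" "i \<noteq> k" "j \<noteq> k"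
    and di: "2 \<le> d i" and dk: "1 \<le> d k" "d k \<le> d i"
    and lt: "d i + d k < n" and dj: "n \<le> d i + d j"
  shows "solvable n c"
proof -
  have "\<exists>B\<subseteq>row_set n c j. card B = n - d i - d k \<and> (d i + 2 = n \<longrightarrow> B \<inter> row_set n c k = {})"
  proof (cases "d i + 2 = n")
    case True
    then have "d k = 1"
      using lt dk by simp
    \<comment> \<open>Row \<open>j\<close> has at least \<open>n - d i = 2\<close> red cells and row
      \<open>k\<close> only one. Choosing the cell of \<open>B\<close> off that column ensures that
      no column is prescribed in both later rows while row \<open>i\<close> is filled.\<close>
    then have "\<not> row_set n c j \<subseteq> row_set n c k"
      using True dj card_mono [of "row_set n c k" "row_set n c j"] by (auto simp: d_def)
    then obtain x where "x \<in> row_set n c j" "x \<notin> row_set n c k"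
      by blast
    then show ?thesis
      using True \<open>d k = 1\<close> by (intro exI [of _ "{x}"]) auto
  next
    case False
    have "n - d i - d k \<le> card (row_set n c j)"
      using dj by (simp add: d_def)
    then obtain B where "B \<subseteq> row_set n c j" "card B = n - d i - d k"
      by (meson obtain_subset_with_card_n)
    then show ?thesis
      using False by blast
  qed
  then obtain B where B: "B \<subseteq> row_set n c j" "card B = n - d i - d k"
    "d i + 2 = n \<Longrightarrow> B \<inter> row_set n c k = {}"
    by blast
  define \<rho> where "\<rho> m = (if m = 0 then i else if m = 1 then j else k)" for m :: nat
  define A where "A m = (if m = 1 then B else row_set n c (\<rho> m))" for m
  have A: "A 0 = row_set n c i" "A 1 = B" "A 2 = row_set n c k"
    by (simp_all add: A_def \<rho>_def)
  have cA: "card (A 0) = d i" "card (A 1) = n - d i - d k" "card (A 2) = d k"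
    using A B(2) by (simp_all add: d_def)
  have ivl: "{..<3::nat} = {0, 1, 2}" "{0<..<3::nat} = {1, 2}" "{1<..<3::nat} = {2}" "{2<..<3::nat} = {}"
    by auto
  have "\<exists>L. latin_rows n {..<n} L \<and> hits_all n c L \<and>
    ((\<exists>k<3. \<exists>k'<3. k \<noteq> k' \<and> A k = row_set n c (\<rho> k) \<and> A k' = row_set n c (\<rho> k'))
      \<longrightarrow> hits_all n (\<lambda>i j. \<not> c i j) L)"
  proof (rule rainbow_hits_all)
    show "A m \<subseteq> row_set n c (\<rho> m)" for m
      using B(1) by (simp add: A_def \<rho>_def)
    show "(\<Sum>m<3. card (A m)) = n"
      using lt cA by (simp add: ivl)
    show "inj_on \<rho> {..<3}" "\<rho> ` {..<3} \<subseteq> {..<n}"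
      using ijk by (auto simp: ivl \<rho>_def)
  next
    fix m :: nat assume "m < 3"
    then consider "m = 0" "d i + 2 = n" | "m = 0" "d i + 3 \<le> n" | "m = 1" | "m = 2"
      using lt dk by linarith
    then show "card (A m) + 3 + m \<le> n \<or> card (A m) + 3 + m \<le> n + 1 \<and>
      ((\<Sum>i\<in>{m<..<3}. card (A i)) + 1 < 3 \<or> (\<forall>x<n. x \<notin> A m \<longrightarrow> (\<exists>i. m < i \<and> i < 3 \<and> x \<notin> A i)))"
    proof cases
      case 1
      have "\<exists>i. m < i \<and> i < 3 \<and> x \<notin> A i" for x
      proof (cases "x \<in> B")
        case True
        then have "x \<notin> A 2"
          using B(3) 1 A by auto
        then show ?thesis
          using 1 by (intro exI [of _ 2]) simp
      next
        case False
        then show ?thesis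
          using 1 A by (intro exI [of _ 1]) simp
      qed
      moreover have "card (A m) + 3 + m \<le> n + 1"
        using 1 cA by simp
      ultimately show ?thesis
        by blast
    next
      case 2
      then show ?thesis
        using cA by simp
    next
      case 3
      have "(\<Sum>i\<in>{m<..<3}. card (A i)) = d k"
        unfolding 3 using cA(3) by (simp only: ivl) simp
      moreover have "card (A m) = n - d i - d k"
        unfolding 3 by (rule cA)
      \<comment> \<open>The first inequality fails only for \<open>d i = 2\<close> and
        \<open>d k = 1\<close>; then the one cell of the last row is few enough for the second
        alternative.\<close>
      moreover have "n - d i - d k + 4 \<le> n \<or> n - d i - d k + 4 \<le> n + 1 \<and> d k + 1 < 3"
        using di dk lt by linarith
      ultimately show ?thesis
        using 3 by auto
    next
      case 4
      \<comment> \<open>From \<open>2 * d k < n\<close> and \<open>n \<ge> 7\<close>.\<close>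
      have "d k + 5 \<le> n + 1"
        using dk lt n by linarith
      then show ?thesis
        using 4 cA by (simp add: ivl)
    qed
  qed
  moreover have "(0::nat) < 3 \<and> (2::nat) < 3 \<and> (0::nat) \<noteq> 2 \<and>
      A 0 = row_set n c (\<rho> 0) \<and> A 2 = row_set n c (\<rho> 2)"
    by (simp add: A_def)
  ultimately show ?thesis
    unfolding solvable_def by blast
qed

section \<open>Colorings whose rows are monochromatic up to one cell\<close>

lemma card_row_set_one:
  assumes "card (row_set n c i) = 1" "x < n" "c i x" "y < n"
  shows "c i y \<longleftrightarrow> y = x"
proof -
  obtain z where "row_set n c i = {z}"
    using assms(1) by (meson card_1_singletonE)
  then have "c i u \<longleftrightarrow> u = z" if "u < n" for u
    using that by (auto simp: row_set_def)
  then show ?thesis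
    using assms by metis
qed

text \<open>If the red cell of some nearly blue row lies above or below a red cell of some nearly
  red row, \<open>solvable_pair\<close> applies to these two rows. Otherwise all exceptional cells
  lie in one column \<open>x\<close>, and every Latin square works.\<close>

lemma solvable_extreme:
  fixes n :: nat and c :: "nat \<Rightarrow> nat \<Rightarrow> bool"
  defines "d i \<equiv> card (row_set n c i)"
  assumes n: "n \<ge> 7"
    and total: "(\<Sum>i<n. d i) \<ge> 2 * n - 1" "(\<Sum>i<n. n - d i) \<ge> 2 * n - 1"
    and d: "\<And>i. i < n \<Longrightarrow> d i = 1 \<or> d i = n - 1"
    and i: "i < n" "d i = n - 1" and k: "k < n" "d k = 1"
  shows "solvable n c"
proof (cases "\<exists>p<n. \<exists>q<n. d p = n - 1 \<and> d q = 1 \<and> (\<forall>x<n. c q x \<longrightarrow> c p x)")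
  case True
  then obtain p q where pq: "p < n" "q < n" "d p = n - 1" "d q = 1" "\<forall>x<n. c q x \<longrightarrow> c p x"
    by blast
  have "p \<noteq> q"
    using pq(3,4) n by auto
  then show ?thesis
    using solvable_pair [of p n q c] pq n by (simp add: d_def)
next
  case False
  then have ex: "\<exists>x<n. c q x \<and> \<not> c p x" if "p < n" "q < n" "d p = n - 1" "d q = 1" for p q
    using that by blast
  obtain x where x: "x < n" "c k x" "\<not> c i x"
    using ex [OF i(1) k(1) i(2) k(2)] by blast
  have notc: "card (row_set n (\<lambda>i j. \<not> c i j) p) = 1" if "d p = n - 1" for p
    using that n by (simp add: card_row_set_not d_def)
  have low: "c q y \<longleftrightarrow> y = x" if q: "q < n" "d q = 1" and y: "y < n" for q y
  proof -
    obtain x' where x': "x' < n" "c q x'" "\<not> c i x'"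
      using ex [OF i(1) q(1) i(2) q(2)] by blast
    have "\<not> c i x' \<longleftrightarrow> x' = x"
      using notc [OF i(2)] x(1,3) x'(1) by (rule card_row_set_one)
    moreover have "c q y \<longleftrightarrow> y = x'"
      using q(2) [unfolded d_def] x'(1,2) y by (rule card_row_set_one)
    ultimately show ?thesis
      using x'(3) by blast
  qed
  have high: "c p y \<longleftrightarrow> y \<noteq> x" if p: "p < n" "d p = n - 1" and y: "y < n" for p y
  proof -
    obtain x' where x': "x' < n" "c k x'" "\<not> c p x'"
      using ex [OF p(1) k(1) p(2) k(2)] by blast
    have "x' = x"
      using low [OF k x'(1)] x'(2) by blast
    moreover have "\<not> c p y \<longleftrightarrow> y = x'"
      using notc [OF p(2)] x'(1,3) y by (rule card_row_set_one)
    ultimately show ?thesis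
      by blast
  qed
  \<comment> \<open>With only one nearly red row there would be \<open>(n - 1) + (n - 1)\<close> red
    cells, one too few. The same count of blue cells gives a second nearly blue row below.\<close>
  have "\<exists>p<n. p \<noteq> i \<and> d p = n - 1"
  proof (rule ccontr)
    assume "\<not> ?thesis"
    then have "d p = 1" if "p \<in> {..<n} - {i}" for p
      using d [of p] that by blast
    then have "(\<Sum>p\<in>{..<n} - {i}. d p) = (\<Sum>p\<in>{..<n} - {i}. 1)"
      by (rule sum.cong [OF refl])
    moreover have "(\<Sum>p<n. d p) = d i + (\<Sum>p\<in>{..<n} - {i}. d p)"
      using i(1) by (intro sum.remove) auto
    ultimately show False
      using total(1) i n by simp
  qed
  then obtain p where p: "p < n" "p \<noteq> i" "d p = n - 1"
    by blast
  have "\<exists>q<n. q \<noteq> k \<and> d q = 1"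
  proof (rule ccontr)
    assume "\<not> ?thesis"
    then have "n - d q = 1" if "q \<in> {..<n} - {k}" for q
      using d [of q] that n by fastforce
    then have "(\<Sum>q\<in>{..<n} - {k}. n - d q) = (\<Sum>q\<in>{..<n} - {k}. 1)"
      by (rule sum.cong [OF refl])
    moreover have "(\<Sum>q<n. n - d q) = (n - d k) + (\<Sum>q\<in>{..<n} - {k}. n - d q)"
      using k(1) by (intro sum.remove) auto
    ultimately show False
      using total(2) k n by simp
  qed
  then obtain q where q: "q < n" "q \<noteq> k" "d q = 1"
    by blast
  obtain L where L: "latin_rows n {..<n} L"
    using latin_rows_exist by blast
  \<comment> \<open>A symbol occurs only once in column \<open>x\<close>, so in one of any two rows
    it lies off that column. Applied to two nearly red rows this gives a red occurrence, to two
    nearly blue rows a blue one.\<close>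
  have avoid: "\<exists>r\<in>{u, v}. \<exists>j<n. j \<noteq> x \<and> L r j = s"
    if uvs: "u < n" "v < n" "u \<noteq> v" "s < n" for u v s
  proof -
    have "L u x \<noteq> L v x"
      using latin_rows_col_inj [OF L, of u v x] uvs x(1) by auto
    then obtain r where r: "r \<in> {u, v}" "L r x \<noteq> s"
      by blast
    have "r < n"
      using r(1) uvs by auto
    then obtain j where "j < n" "L r j = s"
      using latin_rows_obtain [OF L _ uvs(4)] by blast
    then show ?thesis
      using r by blast
  qed
  have "hits_all n c L"
    unfolding hits_all_def
  proof (intro allI impI)
    fix s assume "s < n"
    then obtain r j where "r \<in> {i, p}" "j < n" "j \<noteq> x" "L r j = s"
      using avoid [of i p s] i p by blast
    then show "\<exists>i<n. \<exists>j<n. c i j \<and> L i j = s"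
      using high [of r j] i p by blast
  qed
  moreover have "hits_all n (\<lambda>i j. \<not> c i j) L"
    unfolding hits_all_def
  proof (intro allI impI)
    fix s assume "s < n"
    then obtain r j where "r \<in> {k, q}" "j < n" "j \<noteq> x" "L r j = s"
      using avoid [of k q s] k q by blast
    then show "\<exists>i<n. \<exists>j<n. \<not> c i j \<and> L i j = s"
      using low [of r j] k q by blast
  qed
  ultimately show ?thesis
    using L by (auto simp: solvable_def)
qed

section \<open>Combining the cases\<close>

text \<open>Here \<open>i\<close> is a row with the most and \<open>k\<close> one with the fewest
  red cells. If together they have fewer than \<open>n\<close>, a third row fills up; if they have
  exactly \<open>n\<close>, they suffice alone unless \<open>d i = n - 1\<close>.\<close>

lemma solvable_mixed:
  fixes n :: nat and c :: "nat \<Rightarrow> nat \<Rightarrow> bool"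
  defines "d i \<equiv> card (row_set n c i)"
  assumes n: "n \<ge> 7"
    and total: "(\<Sum>i<n. d i) \<ge> 2 * n - 1" "(\<Sum>i<n. n - d i) \<ge> 2 * n - 1"
    and mixed: "\<And>i. i < n \<Longrightarrow> 0 < d i \<and> d i < n"
    and dense: "\<exists>p<n. \<exists>q<n. p \<noteq> q \<and> n \<le> d p + d q"
    and ik: "i < n" "k < n" "i \<noteq> k" and le: "d i + d k \<le> n"
    and ext: "\<And>p. p < n \<Longrightarrow> d k \<le> d p \<and> d p \<le> d i"
  shows "solvable n c"
proof -
  obtain p q where pq: "p < n" "q < n" "p \<noteq> q" "n \<le> d p + d q"
    using dense by blast
  consider "d i + d k < n" | "d i + d k = n" "d i + 2 \<le> n" | "d i + d k = n" "d i = n - 1"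
    using le mixed [OF ik(1)] by linarith
  then show ?thesis
  proof cases
    case 1
    \<comment> \<open>One row of the dense pair differs from \<open>i\<close>. The other can be
      replaced by \<open>i\<close>, which has at least as many red cells.\<close>
    obtain j where j: "j < n" "j \<noteq> i" "n \<le> d i + d j"
    proof (cases "p = i")
      case True
      then show thesis
        using that [of q] pq by simp
    next
      case False
      then show thesis
        using that [of p] pq ext [of q] by simp
    qed
    have "j \<noteq> k"
      using j 1 by auto
    moreover have "2 \<le> d i"
      using j ext [of j] n by simp
    ultimately show ?thesis
      using solvable_triple [of n i j k c] n ik j 1 mixed [OF ik(2)] ext [OF ik(1)]
      by (simp add: d_def)
  next
    case 2
    then show ?thesis
      using solvable_pair [of i n k c] ik mixed [OF ik(1)] ext [OF ik(1)] by (simp add: d_def)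
  next
    case 3
    then have dk: "d k = 1"
      using n by simp
    show ?thesis
    proof (cases "\<exists>r<n. 2 \<le> d r \<and> d r + 2 \<le> n")
      case True
      then obtain r where r: "r < n" "2 \<le> d r" "d r + 2 \<le> n"
        by blast
      then have "r \<noteq> i" "r \<noteq> k"
        using 3 dk n by auto
      \<comment> \<open>Now \<open>r\<close> and \<open>k\<close> are the completely selected rows,
        and the nearly red row \<open>i\<close> only supplies the missing cells.\<close>
      then show ?thesis
        using solvable_triple [of n r i k c] n ik r 3 dk by (simp add: d_def)
    next
      case False
      then have "d r = 1 \<or> d r = n - 1" if "r < n" for r
        using that mixed [OF that] by fastforce
      then show ?thesis
        using solvable_extreme [of n c i k] n total ik 3 dk by (simp add: d_def)
    qed
  qed
qed

text \<open>Every symbol occurs in the blue row \<open>i\<close>, so only red occurrences matter. An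
  entirely red row supplies them in any Latin square; without one, \<open>greedy_rows\<close>
  does.\<close>

lemma solvable_mono_row:
  fixes n :: nat and c :: "nat \<Rightarrow> nat \<Rightarrow> bool"
  defines "d i \<equiv> card (row_set n c i)"
  assumes n: "n \<ge> 7" and total: "(\<Sum>i<n. d i) \<ge> 2 * n - 1" and i: "i < n" "d i = 0"
  shows "solvable n c"
proof -
  have "\<not> c i j" if "j < n" for j
    using i(2) that by (auto simp: d_def row_set_def)
  then have none: "hits_all n (\<lambda>i j. \<not> c i j) L" if "latin_rows n {..<n} L" for L
    using hits_all_full_row [OF that i(1)] by simp
  show ?thesis
  proof (cases "\<exists>k<n. d k = n")
    case True
    then obtain k where k: "k < n" "d k = n"
      by blast
    have "row_set n c k = {..<n}"
      using k(2) row_set_subset [of n c k] by (simp add: d_def card_subset_eq)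
    then have "c k j" if "j < n" for j
      using that by (auto simp: row_set_def)
    then have "hits_all n c L" if "latin_rows n {..<n} L" for L
      using hits_all_full_row [OF that k(1)] by simp
    then show ?thesis
      using none latin_rows_exist unfolding solvable_def by blast
  next
    case False
    have "card (row_set n c k) < n" if "k < n" for k
    proof -
      have "d k \<noteq> n"
        using False that by blast
      then show ?thesis
        using card_row_set_le [of n c k] by (simp add: d_def)
    qed
    then show ?thesis
      using greedy_rows [of n c] n total none unfolding solvable_def d_def by blast
  qed
qed

lemma solvable_two_coloring:
  fixes n :: nat and c :: "nat \<Rightarrow> nat \<Rightarrow> bool"
  assumes n: "n \<ge> 7"
    and total: "(\<Sum>i<n. card (row_set n c i)) \<ge> 2 * n - 1"
      "(\<Sum>i<n. card (row_set n (\<lambda>i j. \<not> c i j) i)) \<ge> 2 * n - 1"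
  shows "solvable n c"
proof -
  define d where "d i = card (row_set n c i)" for i
  define d' where "d' i = card (row_set n (\<lambda>i j. \<not> c i j) i)" for i
  have d': "d' i = n - d i" and dn: "d i \<le> n" for i
    by (simp_all add: d_def d'_def card_row_set_not card_row_set_le)
  have tot: "(\<Sum>i<n. d i) \<ge> 2 * n - 1" "(\<Sum>i<n. n - d i) \<ge> 2 * n - 1"
    "(\<Sum>i<n. d' i) \<ge> 2 * n - 1" "(\<Sum>i<n. n - d' i) \<ge> 2 * n - 1"
    using total dn by (simp_all add: d_def d'_def card_row_set_not)
  consider (blue) i where "i < n" "d i = 0" | (red) i where "i < n" "d' i = 0"
    | (mixed) "\<And>i. i < n \<Longrightarrow> 0 < d i \<and> d i < n"
    using d' dn by (metis diff_is_0_eq not_gr_zero not_le)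
  then show ?thesis
  proof cases
    case blue
    then show ?thesis
      using solvable_mono_row [of n c i] n tot by (simp add: d_def)
  next
    case red
    then have "solvable n (\<lambda>i j. \<not> c i j)"
      using solvable_mono_row [of n "\<lambda>i j. \<not> c i j" i] n tot by (simp add: d'_def)
    then show ?thesis
      by (simp add: solvable_not)
  next
    case mixed
    have mixed': "0 < d' i \<and> d' i < n" if "i < n" for i
      using mixed [OF that] d' [of i] by simp
    consider (sparse) "\<forall>i<n. \<forall>j<n. i \<noteq> j \<longrightarrow> d i + d j < n"
      | (sparse') "\<forall>i<n. \<forall>j<n. i \<noteq> j \<longrightarrow> d' i + d' j < n"
      | (dense) "\<exists>p<n. \<exists>q<n. p \<noteq> q \<and> n \<le> d p + d q" "\<exists>p<n. \<exists>q<n. p \<noteq> q \<and> n \<le> d' p + d' q"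
      by (meson not_le)
    then show ?thesis
    proof cases
      case sparse
      then show ?thesis
        using greedy_rows [of n c] n tot mixed unfolding solvable_def d_def by blast
    next
      case sparse'
      have "solvable n (\<lambda>i j. \<not> c i j)"
        using greedy_rows [of n "\<lambda>i j. \<not> c i j"] n tot mixed' sparse'
        unfolding solvable_def d'_def by blast
      then show ?thesis
        by (simp add: solvable_not)
    next
      case dense
      obtain \<rho> where \<rho>: "bij_betw \<rho> {..<n} {..<n}" "\<forall>j<n. \<forall>i\<le>j. d (\<rho> j) \<le> d (\<rho> i)"
        using descending_enumeration [of n d] by blast
      define i where "i = \<rho> 0"
      define k where "k = \<rho> (n - 1)"
      have ik: "i < n" "k < n" "i \<noteq> k"
        using bij_betwE [OF \<rho>(1)] inj_onD [OF bij_betw_imp_inj_on [OF \<rho>(1)], of 0 "n - 1"] n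
        by (auto simp: i_def k_def)
      have ext: "d k \<le> d p \<and> d p \<le> d i" if p: "p < n" for p
      proof -
        have "p \<in> \<rho> ` {..<n}"
          using \<rho>(1) p by (simp add: bij_betw_def)
        then obtain m where "m < n" "p = \<rho> m"
          by auto
        then show ?thesis
          using \<rho>(2) by (simp add: i_def k_def)
      qed
      show ?thesis
      proof (cases "d i + d k \<le> n")
        case True
        then show ?thesis
          using solvable_mixed [of n c i k] n tot mixed dense(1) ik ext by (simp add: d_def)
      next
        case False
        \<comment> \<open>Exchanging the colors replaces the sum \<open>d i + d k\<close> by its
          difference from \<open>2 * n\<close>, which is now below \<open>n\<close>, and swaps the
          roles of \<open>i\<close> and \<open>k\<close>.\<close>
        have ext': "d' i \<le> d' p \<and> d' p \<le> d' k" if "p < n" for p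
          using ext [OF that] d' by (simp add: diff_le_mono2)
        have le': "d' k + d' i \<le> n"
          using False d' by simp
        have "solvable n (\<lambda>i j. \<not> c i j)"
          using solvable_mixed [of n "\<lambda>i j. \<not> c i j" k i] n tot mixed' dense(2) ik ext' le'
          by (simp add: d'_def)
        then show ?thesis
          by (simp add: solvable_not)
      qed
    qed
  qed
qed

section \<open>Matchings of the complete bipartite graph\<close>

lemma edge_eq_iff: "{Inl i, Inr j} = {Inl i', Inr j'} \<longleftrightarrow> i = i' \<and> j = j'"
  by (auto simp: doubleton_eq_iff)

lemma edge_mem_iff: "{Inl i, Inr j} \<in> complete_bipartite_edges n \<longleftrightarrow> i < n \<and> j < n"
  by (simp add: complete_bipartite_edges_def edge_eq_iff)

lemma card_color_class:
  "card (color_class (complete_bipartite_edges n) f a) =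
    (\<Sum>i<n. card (row_set n (\<lambda>i j. f {Inl i, Inr j} = a) i))"
proof -
  let ?R = "row_set n (\<lambda>i j. f {Inl i, Inr j} = a)"
  have "color_class (complete_bipartite_edges n) f a = (\<lambda>(i, j). {Inl i, Inr j}) ` Sigma {..<n} ?R"
    by (auto simp: color_class_def complete_bipartite_edges_def row_set_def edge_eq_iff)
  moreover have "inj_on (\<lambda>(i, j). {Inl i, Inr j}) (Sigma {..<n} ?R)"
    by (auto simp: inj_on_def edge_eq_iff)
  ultimately show ?thesis
    by (simp add: card_image card_SigmaI)
qed

theorem theorem5:
  fixes n :: nat and f :: "(nat + nat) set \<Rightarrow> nat"
  assumes "n \<ge> 7"
    and "f \<in> complete_bipartite_edges n \<rightarrow> {1, 2}"
    and "\<forall>i\<in>{1, 2}. card (color_class (complete_bipartite_edges n) f i) \<ge> 2 * n - 1"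
  shows "\<exists>\<M>. partition_on (complete_bipartite_edges n) \<M> \<and> card \<M> = n \<and>
           (\<forall>P\<in>\<M>. balanced_matching (complete_bipartite_edges n) f P)"
proof -
  let ?E = "complete_bipartite_edges n"
  define c where "c i j \<longleftrightarrow> f {Inl i, Inr j} = 1" for i j
  have two: "f {Inl i, Inr j} = 2 \<longleftrightarrow> \<not> c i j" if "i < n" "j < n" for i j
  proof -
    have "{Inl i, Inr j} \<in> ?E"
      using that by (simp add: edge_mem_iff)
    then have "f {Inl i, Inr j} \<in> {1, 2}"
      using assms(2) by blast
    then show ?thesis
      by (auto simp: c_def)
  qed
  have "row_set n (\<lambda>i j. f {Inl i, Inr j} = 2) i = row_set n (\<lambda>i j. \<not> c i j) i" if "i < n" for i
    using two that by (auto simp: row_set_def)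
  then have "(\<Sum>i<n. card (row_set n (\<lambda>i j. \<not> c i j) i)) \<ge> 2 * n - 1"
    using assms(3) by (simp add: card_color_class)
  moreover have "(\<Sum>i<n. card (row_set n c i)) \<ge> 2 * n - 1"
    using assms(3) by (simp add: card_color_class c_def [abs_def])
  ultimately have "solvable n c"
    using solvable_two_coloring assms(1) by blast
  then obtain L where L: "latin_rows n {..<n} L" "hits_all n c L" "hits_all n (\<lambda>i j. \<not> c i j) L"
    by (auto simp: solvable_def)
  define P where "P s = {{Inl i, Inr j} | i j. i < n \<and> j < n \<and> L i j = s}" for s
  have row_inj: "j = j'" if "i < n" "j < n" "j' < n" "L i j = L i j'" for i j j'
    using inj_onD [OF bij_betw_imp_inj_on [OF latin_rows_bij [OF L(1)]], of i j j'] that by simp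
  have col_inj: "i = i'" if "i < n" "i' < n" "j < n" "L i j = L i' j" for i i' j
    using latin_rows_col_inj [OF L(1)] that by simp
  have Ln: "L i j < n" if "i < n" "j < n" for i j
    using bij_betwE [OF latin_rows_bij [OF L(1)], of i] that by simp
  have bal: "balanced_matching ?E f (P s)" if s: "s < n" for s
  proof -
    \<comment> \<open>Two edges of \<open>P s\<close> sharing a left vertex lie in one row, two
      sharing a right vertex in one column; in both cases the equal symbol \<open>s\<close> makes
      them coincide.\<close>
    have "disjoint (P s)"
      using row_inj col_inj by (auto simp: P_def disjoint_def)
    moreover have "P s \<subseteq> ?E"
      by (auto simp: P_def complete_bipartite_edges_def)
    moreover obtain i j where "i < n" "j < n" "c i j" "L i j = s"
      using L(2) s by (auto simp: hits_all_def)
    then have "{Inl i, Inr j} \<in> color_class ?E f 1 \<inter> P s"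
      by (auto simp: color_class_def edge_mem_iff P_def c_def)
    moreover obtain i' j' where "i' < n" "j' < n" "\<not> c i' j'" "L i' j' = s"
      using L(3) s by (auto simp: hits_all_def)
    then have "{Inl i', Inr j'} \<in> color_class ?E f 2 \<inter> P s"
      using two by (auto simp: color_class_def edge_mem_iff P_def)
    ultimately show ?thesis
      by (auto simp: balanced_matching_def matching_def)
  qed
  \<comment> \<open>Besides excluding an empty block, this makes \<open>P\<close> injective on
    disjoint classes, so there are exactly \<open>n\<close> matchings.\<close>
  have nonempty: "P s \<noteq> {}" if "s < n" for s
    using bal [OF that] by (auto simp: balanced_matching_def)
  have disj: "P s \<inter> P s' = {}" if "s \<noteq> s'" for s s'
    using that by (auto simp: P_def edge_eq_iff)
  have "partition_on ?E (P ` {..<n})"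
  proof (rule partition_onI)
    show "\<Union>(P ` {..<n}) = ?E"
      using Ln by (auto simp: P_def complete_bipartite_edges_def)
    show "disjnt Q Q'" if Q: "Q \<in> P ` {..<n}" "Q' \<in> P ` {..<n}" "Q \<noteq> Q'" for Q Q'
    proof -
      obtain s s' where "Q = P s" "Q' = P s'"
        using Q(1,2) by blast
      then show ?thesis
        using disj [of s s'] Q(3) by (auto simp: disjnt_def)
    qed
    show "{} \<notin> P ` {..<n}"
      using nonempty by auto
  qed
  moreover have "inj_on P {..<n}"
  proof (rule inj_onI)
    fix s s' assume "s \<in> {..<n}" "P s = P s'"
    then show "s = s'"
      using nonempty [of s] disj [of s s'] by auto
  qed
  then have "card (P ` {..<n}) = n"
    by (simp add: card_image)
  ultimately show ?thesis
    using bal by (intro exI [of _ "P ` {..<n}"]) auto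
qed

end
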